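(* Let $k(s)$ be the curvature of a real analytic plane curve, parametrized by arc length $s$, and let $K(q)$ be its holomorphic continuation. Then the holomorphic differential $$\Omega=K(q)\,dq$$ determines locally a conformal coordinate net through $$z_q=\exp\left(i\int\Omega\right).$$
   Context: Here $q=q^1+iq^2$ is a complex coordinate with $q^1,q^2$ real. The initial curve is $\{q^2=0\}$, on which $q^1=s$ is arc length. The holomorphic continuation $K(q)$ of the real analytic function $k(q^1)=\sum_{n\ge 0}a_n(q^1)^n$ is obtained by replacing the real coordinate $q^1$ by $q$, i.e. $K(q)=\sum_{n\ge 0}a_nq^n$, so that $\Omega$ restricts to $k\,ds$ on the initial curve. The map $z=z(q)$ is a conformal coordinate transformation, $z_q=dz/dq$ is its derivative, and $\int\Omega$ is an integral (antiderivative) of $\Omega$. The corresponding conformal coordinate net has the metric $ds^2=H^2\bigl((dq^1)^2+(dq^2)^2\bigr)$ with conformal factor $H=|z_q|>0$, with the arc-length normalization $H=1$ chosen on the initial curve $q^2=0$ (in this metric formula $ds$ denotes the line element of the plane). *)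

theory Defs
  imports "HOL-Complex_Analysis.Complex_Analysis"
begin

text \<open>The Euclidean plane is identified with the complex numbers.\<close>

definition real_analytic_on :: "(real \<Rightarrow> complex) \<Rightarrow> real set \<Rightarrow> bool" where
  "real_analytic_on f I \<longleftrightarrow>
     (\<forall>s0\<in>I. \<exists>(a :: nat \<Rightarrow> complex) r. r > 0 \<and>
        (\<forall>s. \<bar>s - s0\<bar> < r \<longrightarrow> (\<lambda>n. a n * of_real (s - s0) ^ n) sums f s))"

definition arc_length_param_on :: "(real \<Rightarrow> complex) \<Rightarrow> real set \<Rightarrow> bool" where
  "arc_length_param_on \<gamma> I \<longleftrightarrow> (\<forall>s\<in>I. norm (vector_derivative \<gamma> (at s)) = 1)"

text \<open>Signed curvature: the numerator is the determinant of the pair formed by the first and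
  the second derivative, because the determinant of \<open>(u, v)\<close> is \<open>Im (cnj u * v)\<close>.\<close>

definition signed_curvature :: "(real \<Rightarrow> complex) \<Rightarrow> real \<Rightarrow> real" where
  "signed_curvature \<gamma> s =
     (let d1 = vector_derivative \<gamma> (at s);
          d2 = vector_derivative (\<lambda>t. vector_derivative \<gamma> (at t)) (at s)
      in Im (cnj d1 * d2) / norm d1 ^ 3)"

text \<open>\<open>K\<close> is a holomorphic continuation of \<open>k\<close> near \<open>s0\<close>: the same real coefficients expand both
  functions, with the real variable replaced by the complex one.\<close>

definition holomorphic_continuation_at :: "real \<Rightarrow> (real \<Rightarrow> real) \<Rightarrow> (complex \<Rightarrow> complex) \<Rightarrow> bool" where
  "holomorphic_continuation_at s0 k K \<longleftrightarrow>
     (\<exists>(a :: nat \<Rightarrow> real) r. r > 0 \<and>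
        (\<forall>s. \<bar>s - s0\<bar> < r \<longrightarrow> (\<lambda>n. a n * (s - s0) ^ n) sums k s) \<and>
        (\<forall>q. norm (q - of_real s0) < r \<longrightarrow>
              (\<lambda>n. of_real (a n) * (q - of_real s0) ^ n) sums K q))"

text \<open>The equation \<open>dz/dq = exp (\<i> \<integral>\<Omega>)\<close> on \<open>U\<close> for \<open>\<Omega> = K(q) dq\<close>; here \<open>F\<close> is an antiderivative
  of \<open>\<Omega>\<close>, whose constant of integration is left free.\<close>

definition exp_integral_equation_on ::
    "complex set \<Rightarrow> (complex \<Rightarrow> complex) \<Rightarrow> (complex \<Rightarrow> complex) \<Rightarrow> bool" where
  "exp_integral_equation_on U K z \<longleftrightarrow>
     (\<exists>F. \<forall>q\<in>U. (F has_field_derivative K q) (at q) \<and>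
                 (z has_field_derivative exp (\<i> * F q)) (at q))"

definition conformal_factor :: "(complex \<Rightarrow> complex) \<Rightarrow> complex \<Rightarrow> real" where
  "conformal_factor z q = norm (deriv z q)"

text \<open>The last conjunct is the metric formula
  \<open>ds\<^sup>2 = H\<^sup>2 ((dq\<^sup>1)\<^sup>2 + (dq\<^sup>2)\<^sup>2)\<close>, evaluated on a tangent vector \<open>v\<close> whose coordinates
  are \<open>dq\<^sup>1 = Re v\<close> and \<open>dq\<^sup>2 = Im v\<close>.\<close>

definition conformal_net_on :: "complex set \<Rightarrow> (complex \<Rightarrow> complex) \<Rightarrow> bool" where
  "conformal_net_on U z \<longleftrightarrow>
     open U \<and> z holomorphic_on U \<and> inj_on z U \<and>
     (\<forall>q\<in>U. conformal_factor z q > 0 \<and>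
        (\<forall>v. (norm (frechet_derivative z (at q) v))\<^sup>2 =
              (conformal_factor z q)\<^sup>2 * ((Re v)\<^sup>2 + (Im v)\<^sup>2)))"

end

theory Submission
  imports Defs
begin

text \<open>Let \<open>\<Gamma>\<close> be the holomorphic extension of the curve \<open>\<gamma>\<close> near \<open>s0\<close>, obtained by inserting a
  complex variable into its power series. The point of the proof is that \<open>\<Gamma>\<close> itself is the
  conformal map in question. Since \<open>\<gamma>\<close> has unit speed, its acceleration is normal to it, which in
  complex notation is the Frenet equation \<open>\<gamma>'' = \<i> k \<gamma>'\<close>
  (\<open>unit_speed_derivative_is_normal\<close>). By the identity theorem this equation propagates
  from the real axis to \<open>\<Gamma>'' = \<i> K \<Gamma>'\<close> on a disc, for every holomorphic continuation \<open>K\<close> of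
  \<open>k\<close>. Integrating this first-order linear equation for \<open>\<Gamma>'\<close> gives \<open>\<Gamma>' = exp (\<i> F)\<close> with
  \<open>F' = K\<close>, the initial value of \<open>\<Gamma>'\<close> being absorbed into the constant of integration
  (\<open>complexified_curve_solves_exp_integral_equation\<close>). On the real axis \<open>\<bar>\<Gamma>'\<bar> = \<bar>\<gamma>'\<bar> = 1\<close>;
  in particular \<open>\<Gamma>'\<close> does not vanish at \<open>s0\<close>, so \<open>\<Gamma>\<close> is injective, and hence conformal, on a
  small disc.

  The existence of a continuation \<open>K\<close> uses the same equation: \<open>- \<i> \<Gamma>'' / \<Gamma>'\<close> is holomorphic
  and equals \<open>k\<close> on the real axis, so that the real parts of its Taylor coefficients expand \<open>k\<close>.

  Finally, two solutions of \<open>z' = exp (\<i> \<integral>\<Omega>)\<close> have antiderivatives of \<open>\<Omega>\<close> that differ by a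
  constant \<open>C\<close>, so their derivatives differ by the factor \<open>exp (\<i> C)\<close>. The normalization \<open>H = 1\<close>
  at \<open>s0\<close> forces this factor to have modulus \<open>1\<close>: the net is determined up to a rigid
  motion (\<open>exp_integral_equation_unique\<close>).\<close>


section \<open>From the real axis to a complex disc\<close>

lemma of_real_in_ball_iff:
  "complex_of_real s \<in> ball (of_real s0) r \<longleftrightarrow> \<bar>s - s0\<bar> < r"
proof -
  have "dist (complex_of_real s0) (of_real s) = \<bar>s0 - s\<bar>"
    by (metis dist_norm norm_of_real of_real_diff)
  then show ?thesis by (auto simp: abs_minus_commute)
qed

text \<open>Every point of the disc is closer to the centre than some real point of the interval, so
  Abel's lemma applies with that real point.\<close>

lemma powser_summable_on_disc:
  fixes a :: "nat \<Rightarrow> complex" and s0 r :: real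
  assumes conv: "\<And>s. \<bar>s - s0\<bar> < r \<Longrightarrow> summable (\<lambda>n. a n * of_real (s - s0) ^ n)"
    and q: "norm (q - of_real s0) < r"
  shows "summable (\<lambda>n. a n * (q - of_real s0) ^ n)"
proof -
  obtain t where t: "norm (q - of_real s0) < t" "t < r"
    using dense[OF q] by blast
  then have "t > 0" using norm_ge_zero le_less_trans by blast
  then have "summable (\<lambda>n. a n * (of_real t :: complex) ^ n)"
    using conv[of "s0 + t"] t by simp
  then show ?thesis
    by (rule powser_inside) (use t \<open>t > 0\<close> in auto)
qed

text \<open>The identity theorem in the form that carries the Frenet equation over from the curve to the
  disc.\<close>

lemma holomorphic_zero_if_zero_on_reals:
  assumes hol: "f holomorphic_on ball (of_real s0) r"
    and zero: "\<And>s. \<bar>s - s0\<bar> < r \<Longrightarrow> f (of_real s) = 0"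
    and q: "q \<in> ball (of_real s0) r"
  shows "f q = 0"
proof (rule analytic_continuation[OF hol])
  let ?R = "complex_of_real ` {s. \<bar>s - s0\<bar> < r}"
  have "r > 0" using q by (metis ball_eq_empty empty_iff not_less)
  show "of_real s0 islimpt ?R"
    unfolding islimpt_approachable
  proof (intro allI impI)
    fix e :: real assume "e > 0"
    define d where "d = min e r / 2"
    have d: "0 < d" "d < e" "d < r" using \<open>e > 0\<close> \<open>r > 0\<close> by (auto simp: d_def)
    show "\<exists>x'\<in>?R. x' \<noteq> of_real s0 \<and> dist x' (of_real s0) < e"
      by (rule rev_bexI[OF imageI[of "s0 + d"]]) (use d in \<open>auto simp: dist_norm\<close>)
  qed
  show "?R \<subseteq> ball (of_real s0) r"
    by (auto simp: of_real_in_ball_iff simp del: mem_ball)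
  show "of_real s0 \<in> ball (complex_of_real s0) r" using \<open>r > 0\<close> by simp
qed (use zero q in auto)


section \<open>The complexified curve\<close>

text \<open>Differentiating \<open>T \<bullet> T = 1\<close> shows that \<open>cnj T * T'\<close> is purely imaginary. For the tangent
  \<open>T\<close> of a unit-speed curve this is the Frenet equation, as \<open>Im (cnj T * T')\<close> is then the
  curvature.\<close>

lemma unit_speed_derivative_is_normal:
  fixes T :: "real \<Rightarrow> complex"
  assumes D: "(T has_vector_derivative A) (at s)"
    and S: "open S" "s \<in> S" and unit: "\<And>t. t \<in> S \<Longrightarrow> norm (T t) = 1"
  shows "A = \<i> * of_real (Im (cnj (T s) * A)) * T s"
proof -
  have "((\<lambda>t. T t \<bullet> T t) has_vector_derivative (T s \<bullet> A + A \<bullet> T s)) (at s)"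
    by (rule bounded_bilinear.has_vector_derivative[OF bounded_bilinear_inner D D])
  moreover have "((\<lambda>t. T t \<bullet> T t) has_vector_derivative 0) (at s)"
    by (rule has_vector_derivative_transform_within_open[OF has_vector_derivative_const S])
      (use unit in \<open>auto simp: power2_norm_eq_inner[symmetric]\<close>)
  ultimately have "T s \<bullet> A + A \<bullet> T s = 0" by (rule vector_derivative_unique_at)
  then have "T s \<bullet> A = 0" by (simp only: inner_commute[of A])
  then have "Re (cnj (T s) * A) = 0" by (simp add: inner_complex_def)
  then have "cnj (T s) * A = \<i> * of_real (Im (cnj (T s) * A))"
    by (simp add: complex_eq_iff)
  then have "T s * cnj (T s) * A = \<i> * of_real (Im (cnj (T s) * A)) * T s"
    by (metis mult.assoc mult.commute)
  moreover have "T s * cnj (T s) = 1" using unit[OF S(2)] complex_norm_square[of "T s"] by simp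
  ultimately show ?thesis by simp
qed

text \<open>The disc is shrunk until it meets the real axis inside \<open>I\<close> and \<open>\<Gamma>\<close> is injective on it; the
  latter is possible since \<open>\<bar>\<Gamma>' s0\<bar> = \<bar>\<gamma>' s0\<bar> = 1\<close>.\<close>

lemma complexified_unit_speed_curve:
  assumes I: "open I" "s0 \<in> I" and ana: "real_analytic_on \<gamma> I" and unit: "arc_length_param_on \<gamma> I"
  obtains \<Gamma> r where "r > 0" "\<Gamma> holomorphic_on ball (of_real s0) r" "inj_on \<Gamma> (ball (of_real s0) r)"
    and "\<And>s. \<bar>s - s0\<bar> < r \<Longrightarrow> s \<in> I \<and> \<Gamma> (of_real s) = \<gamma> s \<and> norm (deriv \<Gamma> (of_real s)) = 1 \<and>
           deriv (deriv \<Gamma>) (of_real s) = \<i> * of_real (signed_curvature \<gamma> s) * deriv \<Gamma> (of_real s)"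
proof -
  obtain a r1 where "r1 > 0"
    and a: "\<And>s. \<bar>s - s0\<bar> < r1 \<Longrightarrow> (\<lambda>n. a n * of_real (s - s0) ^ n) sums \<gamma> s"
    using ana I unfolding real_analytic_on_def by blast
  define \<Gamma> where "\<Gamma> q = (\<Sum>n. a n * (q - of_real s0) ^ n)" for q
  have sums: "(\<lambda>n. a n * (q - of_real s0) ^ n) sums \<Gamma> q" if "q \<in> ball (of_real s0) r1" for q
    unfolding \<Gamma>_def
    by (intro summable_sums powser_summable_on_disc[of s0 r1])
      (use that a in \<open>auto simp: dist_norm norm_minus_commute intro: sums_summable\<close>)
  then have hol1: "\<Gamma> holomorphic_on ball (of_real s0) r1" by (rule power_series_holomorphic)
  have \<Gamma>_real: "\<Gamma> (of_real s) = \<gamma> s" if "\<bar>s - s0\<bar> < r1" for s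
    using a[OF that] unfolding \<Gamma>_def by (simp add: sums_iff)
  obtain e where "e > 0" and e: "\<And>s. \<bar>s - s0\<bar> < e \<Longrightarrow> s \<in> I"
    using I unfolding open_dist dist_real_def by blast
  define r2 where "r2 = min r1 e"
  have r2: "r2 > 0" "r2 \<le> r1" "r2 \<le> e" using \<open>r1 > 0\<close> \<open>e > 0\<close> by (auto simp: r2_def)
  have hol2: "\<Gamma> holomorphic_on ball (of_real s0) r2"
    using hol1 r2 by (meson holomorphic_on_subset subset_ball)
  have hol2': "deriv \<Gamma> holomorphic_on ball (of_real s0) r2"
    by (simp add: hol2 holomorphic_deriv)
  define S where "S = {s. \<bar>s - s0\<bar> < r2}"
  have "open S" unfolding S_def by (intro open_Collect_less continuous_intros)
  have in_ball: "complex_of_real s \<in> ball (of_real s0) r2" if "s \<in> S" for s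
    using that of_real_in_ball_iff by (auto simp: S_def)
  have \<gamma>': "vector_derivative \<gamma> (at s) = deriv \<Gamma> (of_real s)" if "s \<in> S" for s
  proof (rule vector_derivative_at)
    have "(\<Gamma> has_field_derivative deriv \<Gamma> (of_real s)) (at (of_real s))"
      using hol2 in_ball[OF that] holomorphic_derivI open_ball by blast
    then show "(\<gamma> has_vector_derivative deriv \<Gamma> (of_real s)) (at s)"
      using has_vector_derivative_transform_within_open[OF has_vector_derivative_real_field
          \<open>open S\<close> that] \<Gamma>_real r2 by (force simp: S_def)
  qed
  have unit': "norm (deriv \<Gamma> (of_real s)) = 1" if "s \<in> S" for s
  proof -
    have "s \<in> I" using that e r2 by (auto simp: S_def)
    then show ?thesis using unit unfolding arc_length_param_on_def \<gamma>'[OF that, symmetric] by blast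
  qed
  have frenet: "deriv (deriv \<Gamma>) (of_real s) = \<i> * of_real (signed_curvature \<gamma> s) * deriv \<Gamma> (of_real s)"
    if "s \<in> S" for s
  proof -
    have "(deriv \<Gamma> has_field_derivative deriv (deriv \<Gamma>) (of_real s)) (at (of_real s))"
      using hol2' in_ball[OF that] holomorphic_derivI open_ball by blast
    then have D: "((\<lambda>t. deriv \<Gamma> (of_real t)) has_vector_derivative deriv (deriv \<Gamma>) (of_real s)) (at s)"
      by (rule has_vector_derivative_real_field)
    then have "((\<lambda>t. vector_derivative \<gamma> (at t)) has_vector_derivative
                 deriv (deriv \<Gamma>) (of_real s)) (at s)"
      by (rule has_vector_derivative_transform_within_open[OF _ \<open>open S\<close> that]) (simp add: \<gamma>')
    then have "signed_curvature \<gamma> s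
        = Im (cnj (deriv \<Gamma> (of_real s)) * deriv (deriv \<Gamma>) (of_real s))"
      unfolding signed_curvature_def Let_def
      by (simp only: vector_derivative_at \<gamma>'[OF that] unit'[OF that]) simp
    with unit_speed_derivative_is_normal[OF D \<open>open S\<close> that unit'] show ?thesis by simp
  qed
  have "deriv \<Gamma> (of_real s0) \<noteq> 0" using unit'[of s0] r2 by (auto simp: S_def)
  then obtain r where r: "r > 0" "ball (of_real s0) r \<subseteq> ball (complex_of_real s0) r2"
    "inj_on \<Gamma> (ball (of_real s0) r)"
    using has_complex_derivative_locally_injective[OF hol2] r2 by (metis centre_in_ball open_ball)
  have S: "s \<in> S" if "\<bar>s - s0\<bar> < r" for s
    using that r(2) of_real_in_ball_iff[of s s0] by (auto simp: S_def simp del: mem_ball)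
  show ?thesis
  proof (rule that[OF r(1) _ r(3)])
    show "\<Gamma> holomorphic_on ball (of_real s0) r" using hol2 r(2) holomorphic_on_subset by blast
  next
    fix s assume "\<bar>s - s0\<bar> < r"
    then have "s \<in> S" by (rule S)
    then have "\<bar>s - s0\<bar> < r2" by (simp add: S_def)
    with \<open>s \<in> S\<close> show "s \<in> I \<and> \<Gamma> (of_real s) = \<gamma> s \<and> norm (deriv \<Gamma> (of_real s)) = 1 \<and>
        deriv (deriv \<Gamma>) (of_real s) = \<i> * of_real (signed_curvature \<gamma> s) * deriv \<Gamma> (of_real s)"
      using e r2 \<Gamma>_real unit' frenet by auto
  qed
qed


section \<open>Holomorphic continuation of the curvature\<close>

text \<open>A real function that extends holomorphically has real Taylor coefficients. It is
  enough to take their real parts: for real arguments the series of real parts expands \<open>k\<close>,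
  and hence converges on the whole disc.\<close>

lemma holomorphic_continuation_exists:
  assumes "r > 0" and hol: "f holomorphic_on ball (of_real s0) r"
    and real: "\<And>s. \<bar>s - s0\<bar> < r \<Longrightarrow> f (of_real s) = of_real (k s)"
  shows "\<exists>K. holomorphic_continuation_at s0 k K"
proof -
  define a where "a n = Re ((deriv ^^ n) f (of_real s0) / fact n)" for n
  have a: "(\<lambda>n. a n * (s - s0) ^ n) sums k s" if s: "\<bar>s - s0\<bar> < r" for s
  proof -
    have "(\<lambda>n. (deriv ^^ n) f (of_real s0) / fact n * (of_real s - of_real s0) ^ n)
            sums f (of_real s)"
      using holomorphic_power_series[OF hol] s of_real_in_ball_iff by blast
    then have "(\<lambda>n. Re ((deriv ^^ n) f (of_real s0) / fact n * of_real ((s - s0) ^ n)))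
            sums Re (f (of_real s))"
      by (intro sums_Re) simp
    moreover have "Re (x * of_real y) = Re x * y" for x y by simp
    ultimately show ?thesis using real[OF s] by (simp only: a_def Re_complex_of_real)
  qed
  have summ: "summable (\<lambda>n. of_real (a n) * (q - of_real s0) ^ n)"
    if "norm (q - of_real s0) < r" for q :: complex
  proof (rule powser_summable_on_disc[OF _ that])
    fix s assume "\<bar>s - s0\<bar> < r"
    from sums_of_real[OF a[OF this], where 'a=complex]
    show "summable (\<lambda>n. of_real (a n) * of_real (s - s0) ^ n :: complex)"
      by (simp add: sums_iff)
  qed
  show ?thesis
    unfolding holomorphic_continuation_at_def
    by (rule exI[of _ "\<lambda>q. \<Sum>n. of_real (a n) * (q - of_real s0) ^ n"], rule exI[of _ a],
        rule exI[of _ r])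
      (use \<open>r > 0\<close> a summ in \<open>auto intro: summable_sums\<close>)
qed

lemma holomorphic_continuation_at_imp_holomorphic:
  assumes "holomorphic_continuation_at s0 k K"
  obtains r where "r > 0" "K holomorphic_on ball (of_real s0) r"
    "\<And>s. \<bar>s - s0\<bar> < r \<Longrightarrow> K (of_real s) = of_real (k s)"
proof -
  obtain a r where "r > 0"
    and k: "\<And>s. \<bar>s - s0\<bar> < r \<Longrightarrow> (\<lambda>n. a n * (s - s0) ^ n) sums k s"
    and K: "\<And>q. norm (q - of_real s0) < r \<Longrightarrow>
              (\<lambda>n. of_real (a n) * (q - of_real s0) ^ n) sums K q"
    using assms unfolding holomorphic_continuation_at_def by blast
  show ?thesis
  proof (rule that[OF \<open>r > 0\<close>])
    show "K holomorphic_on ball (of_real s0) r"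
      by (rule power_series_holomorphic[where a = "\<lambda>n. of_real (a n)"])
        (use K in \<open>auto simp: dist_norm norm_minus_commute\<close>)
  next
    fix s assume s: "\<bar>s - s0\<bar> < r"
    have "norm (complex_of_real s - of_real s0) < r"
      using s by (metis norm_of_real of_real_diff)
    from K[OF this] sums_of_real[OF k[OF s], where 'a=complex]
    show "K (of_real s) = of_real (k s)" by (simp add: sums_iff)
  qed
qed


section \<open>The equation for the conformal map\<close>

lemma has_zero_derivative_on_ball_constant:
  fixes f :: "complex \<Rightarrow> complex"
  assumes "\<And>q. q \<in> ball p r \<Longrightarrow> (f has_field_derivative 0) (at q)"
  shows "\<exists>c. \<forall>q\<in>ball p r. f q = c"
  by (rule has_field_derivative_zero_constant[OF convex_ball])
    (use assms in \<open>blast intro: has_field_derivative_at_within\<close>)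

text \<open>With an antiderivative \<open>F\<close> of \<open>K\<close> fixed, the integrating factor \<open>exp (- \<i> F)\<close> makes \<open>\<Gamma>'\<close>
  a constant, and shifting \<open>F\<close> by a logarithm of that constant absorbs it.\<close>

lemma complexified_curve_solves_exp_integral_equation:
  assumes hol: "\<Gamma> holomorphic_on ball p r" and holK: "K holomorphic_on ball p r" and "r > 0"
    and nz: "deriv \<Gamma> p \<noteq> 0"
    and ode: "\<And>q. q \<in> ball p r \<Longrightarrow> deriv (deriv \<Gamma>) q = \<i> * K q * deriv \<Gamma> q"
  shows "exp_integral_equation_on (ball p r) K \<Gamma>"
proof -
  obtain G where "\<And>q. q \<in> ball p r \<Longrightarrow> (G has_field_derivative K q) (at q within ball p r)"
    using holomorphic_convex_primitive'[OF convex_ball open_ball holK] by blast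
  then have G: "(G has_field_derivative K q) (at q)" if "q \<in> ball p r" for q
    using that at_within_open[OF that open_ball] by metis
  have \<Gamma>'': "(deriv \<Gamma> has_field_derivative \<i> * K q * deriv \<Gamma> q) (at q)" if "q \<in> ball p r" for q
    using holomorphic_derivI[OF holomorphic_deriv[OF hol open_ball] open_ball that] ode[OF that]
    by simp
  have "((\<lambda>q. deriv \<Gamma> q * exp (- \<i> * G q)) has_field_derivative 0) (at q)"
    if "q \<in> ball p r" for q
    by (auto intro!: derivative_eq_intros \<Gamma>''[OF that] G[OF that] simp: algebra_simps)
  then have "\<exists>c. \<forall>q\<in>ball p r. deriv \<Gamma> q * exp (- \<i> * G q) = c"
    by (rule has_zero_derivative_on_ball_constant)
  then obtain c where c: "\<And>q. q \<in> ball p r \<Longrightarrow> deriv \<Gamma> q * exp (- \<i> * G q) = c"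
    by blast
  have "c \<noteq> 0" using c[of p] nz \<open>r > 0\<close> by auto
  define F where "F q = G q - \<i> * Ln c" for q
  have "(F has_field_derivative K q) (at q)" if "q \<in> ball p r" for q
    unfolding F_def by (auto intro!: derivative_eq_intros G[OF that])
  moreover have "(\<Gamma> has_field_derivative exp (\<i> * F q)) (at q)" if "q \<in> ball p r" for q
  proof -
    have "exp (\<i> * F q) = exp (\<i> * G q) * c"
      using \<open>c \<noteq> 0\<close> by (simp add: F_def algebra_simps exp_add)
    also have "\<dots> = deriv \<Gamma> q"
      unfolding c[OF that, symmetric] by (simp add: exp_minus field_simps)
    finally show ?thesis using holomorphic_derivI[OF hol open_ball that] by simp
  qed
  ultimately show ?thesis unfolding exp_integral_equation_on_def by blast
qed

text \<open>Multiplying the derivative by \<open>exp (\<i> C)\<close> amounts to adding \<open>C\<close> to the antiderivative, which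
  is the only freedom there is; its modulus can be read off at \<open>p\<close>.\<close>

lemma exp_integral_equation_unique:
  assumes U: "open U" "p \<in> U" "exp_integral_equation_on U K z"
    and V: "open V" "p \<in> V" "exp_integral_equation_on V K w"
    and norm_eq: "norm (deriv w p) = norm (deriv z p)"
  shows "\<exists>c b. norm c = 1 \<and> (\<forall>\<^sub>F q in nhds p. w q = c * z q + b)"
proof -
  obtain F where F: "\<And>q. q \<in> U \<Longrightarrow> (F has_field_derivative K q) (at q)"
    and z: "\<And>q. q \<in> U \<Longrightarrow> (z has_field_derivative exp (\<i> * F q)) (at q)"
    using U(3) unfolding exp_integral_equation_on_def by blast
  obtain G where G: "\<And>q. q \<in> V \<Longrightarrow> (G has_field_derivative K q) (at q)"
    and w: "\<And>q. q \<in> V \<Longrightarrow> (w has_field_derivative exp (\<i> * G q)) (at q)"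
    using V(3) unfolding exp_integral_equation_on_def by blast
  obtain r where "r > 0" and r: "ball p r \<subseteq> U \<inter> V"
    using U V by (meson IntI openE open_Int)
  have "((\<lambda>q. G q - F q) has_field_derivative 0) (at q)" if "q \<in> ball p r" for q
    by (use that r in \<open>auto intro!: derivative_eq_intros F G\<close>)
  then have "\<exists>C. \<forall>q\<in>ball p r. G q - F q = C"
    by (rule has_zero_derivative_on_ball_constant)
  then obtain C where C: "\<And>q. q \<in> ball p r \<Longrightarrow> G q - F q = C"
    by blast
  define c where "c = exp (\<i> * C)"
  have w': "exp (\<i> * G q) = c * exp (\<i> * F q)" if "q \<in> ball p r" for q
    unfolding c_def C[OF that, symmetric] by (simp add: exp_add[symmetric] algebra_simps)
  have "((\<lambda>q. w q - c * z q) has_field_derivative 0) (at q)"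
    if "q \<in> ball p r" for q
    by (use that r w'[OF that] in \<open>auto intro!: derivative_eq_intros z w\<close>)
  then have "\<exists>b. \<forall>q\<in>ball p r. w q - c * z q = b"
    by (rule has_zero_derivative_on_ball_constant)
  then obtain b where b: "\<And>q. q \<in> ball p r \<Longrightarrow> w q - c * z q = b"
    by blast
  have "norm c = 1"
    using norm_eq w'[of p] DERIV_imp_deriv[OF w[OF V(2)]] DERIV_imp_deriv[OF z[OF U(2)]] \<open>r > 0\<close>
    by (simp add: norm_mult)
  moreover have "\<forall>\<^sub>F q in nhds p. w q = c * z q + b"
    unfolding eventually_nhds
    by (rule exI[of _ "ball p r"]) (use b \<open>r > 0\<close> in \<open>auto simp: algebra_simps\<close>)
  ultimately show ?thesis by blast
qed

text \<open>Injective holomorphic maps have nowhere vanishing derivative, and multiplication by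
  \<open>z' q\<close> scales all tangent vectors alike.\<close>

lemma injective_holomorphic_imp_conformal_net:
  assumes U: "open U" and hol: "z holomorphic_on U" and inj: "inj_on z U"
  shows "conformal_net_on U z"
proof -
  have "(norm (frechet_derivative z (at q) v))\<^sup>2
      = (conformal_factor z q)\<^sup>2 * ((Re v)\<^sup>2 + (Im v)\<^sup>2)" if "q \<in> U" for q v
  proof -
    have "(z has_derivative (*) (deriv z q)) (at q)"
      using holomorphic_derivI[OF hol U that] by (simp add: has_field_derivative_def)
    from frechet_derivative_at[OF this, symmetric] show ?thesis
      by (simp add: conformal_factor_def norm_mult power_mult_distrib cmod_power2)
  qed
  moreover have "conformal_factor z q > 0" if "q \<in> U" for q
    using holomorphic_injective_imp_regular[OF hol U inj that] by (simp add: conformal_factor_def)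
  ultimately show ?thesis using assms by (simp add: conformal_net_on_def)
qed


section \<open>The conformal net determined by the curvature\<close>

theorem theorem1:
  fixes \<gamma> :: "real \<Rightarrow> complex" and I :: "real set" and k :: "real \<Rightarrow> real" and s0 :: real
  assumes "open I" and "is_interval I" and "s0 \<in> I"
    and "real_analytic_on \<gamma> I"
    and "arc_length_param_on \<gamma> I"
    and "\<forall>s\<in>I. k s = signed_curvature \<gamma> s"
  shows "(\<exists>K. holomorphic_continuation_at s0 k K) \<and>
    (\<forall>K. holomorphic_continuation_at s0 k K \<longrightarrow>
      (\<exists>U z. of_real s0 \<in> U \<and>
        exp_integral_equation_on U K z \<and>
        conformal_net_on U z \<and>
        (\<forall>s::real. of_real s \<in> U \<longrightarrow>
           s \<in> I \<and> conformal_factor z (of_real s) = 1 \<and> z (of_real s) = \<gamma> s) \<and>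
        (\<forall>V w. open V \<and> of_real s0 \<in> V \<and>
            exp_integral_equation_on V K w \<and>
            (\<forall>s::real. of_real s \<in> V \<longrightarrow> conformal_factor w (of_real s) = 1) \<longrightarrow>
          (\<exists>c b. norm c = 1 \<and>
             (\<forall>\<^sub>F q in nhds (of_real s0). w q = c * z q + b)))))"
proof -
  obtain \<Gamma> r where "r > 0" and hol: "\<Gamma> holomorphic_on ball (of_real s0) r"
    and inj: "inj_on \<Gamma> (ball (of_real s0) r)"
    and curve: "\<And>s. \<bar>s - s0\<bar> < r \<Longrightarrow> s \<in> I \<and> \<Gamma> (of_real s) = \<gamma> s \<and>
          norm (deriv \<Gamma> (of_real s)) = 1 \<and>
          deriv (deriv \<Gamma>) (of_real s) = \<i> * of_real (signed_curvature \<gamma> s) * deriv \<Gamma> (of_real s)"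
    using complexified_unit_speed_curve[OF assms(1,3,4,5)] by metis
  have frenet: "deriv (deriv \<Gamma>) (of_real s) = \<i> * of_real (k s) * deriv \<Gamma> (of_real s)"
    if "\<bar>s - s0\<bar> < r" for s
    using curve[OF that] assms(6) by simp
  have nz: "deriv \<Gamma> q \<noteq> 0" if "q \<in> ball (of_real s0) r" for q
    using holomorphic_injective_imp_regular[OF hol open_ball inj that] .

  have "\<exists>K. holomorphic_continuation_at s0 k K"
  proof (rule holomorphic_continuation_exists[OF \<open>r > 0\<close>])
    show "(\<lambda>q. - \<i> * deriv (deriv \<Gamma>) q / deriv \<Gamma> q) holomorphic_on ball (of_real s0) r"
      by (intro holomorphic_intros holomorphic_deriv hol open_ball nz)
    show "- \<i> * deriv (deriv \<Gamma>) (of_real s) / deriv \<Gamma> (of_real s) = of_real (k s)"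
      if "\<bar>s - s0\<bar> < r" for s
      using frenet[OF that] nz[of "of_real s"] that of_real_in_ball_iff[of s s0 r]
      by (auto simp: field_simps)
  qed

  moreover have "\<exists>U z. of_real s0 \<in> U \<and> exp_integral_equation_on U K z \<and> conformal_net_on U z \<and>
        (\<forall>s::real. of_real s \<in> U \<longrightarrow>
           s \<in> I \<and> conformal_factor z (of_real s) = 1 \<and> z (of_real s) = \<gamma> s) \<and>
        (\<forall>V w. open V \<and> of_real s0 \<in> V \<and> exp_integral_equation_on V K w \<and>
            (\<forall>s::real. of_real s \<in> V \<longrightarrow> conformal_factor w (of_real s) = 1) \<longrightarrow>
          (\<exists>c b. norm c = 1 \<and> (\<forall>\<^sub>F q in nhds (of_real s0). w q = c * z q + b)))"
    if cont: "holomorphic_continuation_at s0 k K" for K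
  proof -
    obtain r' where "r' > 0" and holK': "K holomorphic_on ball (of_real s0) r'"
      and K_real: "\<And>s. \<bar>s - s0\<bar> < r' \<Longrightarrow> K (of_real s) = of_real (k s)"
      using holomorphic_continuation_at_imp_holomorphic[OF cont] by metis
    define \<rho> where "\<rho> = min r r'"
    have \<rho>: "\<rho> > 0" "\<rho> \<le> r" "\<rho> \<le> r'" using \<open>r > 0\<close> \<open>r' > 0\<close> by (auto simp: \<rho>_def)
    define U where "U = ball (complex_of_real s0) \<rho>"
    have U: "open U" "of_real s0 \<in> U" using \<rho> by (auto simp: U_def)
    have sub: "U \<subseteq> ball (of_real s0) r" "U \<subseteq> ball (of_real s0) r'"
      using \<rho> by (auto simp: U_def)
    have hol\<Gamma>: "\<Gamma> holomorphic_on U" and holK: "K holomorphic_on U" and inj\<Gamma>: "inj_on \<Gamma> U"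
      using hol holK' inj sub holomorphic_on_subset inj_on_subset by blast+
    have "(\<lambda>q. deriv (deriv \<Gamma>) q - \<i> * K q * deriv \<Gamma> q) holomorphic_on ball (of_real s0) \<rho>"
      using hol\<Gamma> holK unfolding U_def by (intro holomorphic_intros holomorphic_deriv) auto
    then have ode: "deriv (deriv \<Gamma>) q - \<i> * K q * deriv \<Gamma> q = 0" if "q \<in> U" for q
      by (rule holomorphic_zero_if_zero_on_reals)
        (use that frenet K_real \<rho> in \<open>auto simp: U_def\<close>)
    have eqn: "exp_integral_equation_on U K \<Gamma>"
      unfolding U_def
      by (rule complexified_curve_solves_exp_integral_equation)
        (use hol\<Gamma> holK ode nz[of "of_real s0"] \<rho> \<open>r > 0\<close> in \<open>auto simp: U_def\<close>)
    have on_reals: "s \<in> I \<and> conformal_factor \<Gamma> (of_real s) = 1 \<and> \<Gamma> (of_real s) = \<gamma> s"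
      if "complex_of_real s \<in> U" for s
      using that curve[of s] \<rho> of_real_in_ball_iff[of s s0 \<rho>]
      by (simp add: U_def conformal_factor_def del: mem_ball)
    have "\<exists>c b. norm c = 1 \<and> (\<forall>\<^sub>F q in nhds (of_real s0). w q = c * \<Gamma> q + b)"
      if "open V" "of_real s0 \<in> V" "exp_integral_equation_on V K w"
        and "\<forall>s::real. of_real s \<in> V \<longrightarrow> conformal_factor w (of_real s) = 1" for V w
    proof (rule exp_integral_equation_unique[OF U eqn that(1-3)])
      show "norm (deriv w (of_real s0)) = norm (deriv \<Gamma> (of_real s0))"
        using that(2,4) on_reals[OF U(2)] by (simp add: conformal_factor_def)
    qed
    then show ?thesis
      using U eqn on_reals injective_holomorphic_imp_conformal_net[OF U(1) hol\<Gamma> inj\<Gamma>]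
      by (intro exI[of _ U] exI[of _ \<Gamma>]) blast
  qed
  ultimately show ?thesis by blast
qed

end
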